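(* For each order $n$, the Golden–Wang index $GWI$ is bounded from above on the set $M_R$ of reciprocal matrices of order $n$: there exists $K\in\mathbb{R}$ such that $GWI(A)\le K$ for all $A\in M_R$. (This holds whether the priority vector in the definition of $GWI$ is obtained by the eigenvalue method or by the geometric mean method.)
   Context: $M_R$ is the set of all real $n\times n$ matrices $A=(a_{ij})$ with $a_{ij}>0$ for all $i,j$ and $a_{ij}=1/a_{ji}$ for all $i,j$ (reciprocal matrices). For $A\in M_R$, let $\overline{A}=(\overline{a}_{ij})$ be the matrix obtained from $A$ by dividing each column by the sum of its entries, i.e. $\overline{a}_{ij}=a_{ij}/\sum_{k=1}^n a_{kj}$. Let $\overline{w}=(\overline{w}_1,\dots,\overline{w}_n)$ be the normalized priority vector (positive entries with sum $1$) obtained from $A$ either by the eigenvalue method ($A\overline{w}=\lambda_{\max}\overline{w}$ with $\lambda_{\max}$ the largest, Perron, eigenvalue) or by the geometric mean method ($\overline{w}_i=(\prod_{j}a_{ij})^{1/n}/\sum_{k}(\prod_{j}a_{kj})^{1/n}$). Then $GWI(A)=\frac1n\sum_{i=1}^n\sum_{j=1}^n|\overline{a}_{ij}-\overline{w}_i|$. *)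

theory Defs
  imports "HOL-Analysis.Analysis"
begin

definition reciprocal_matrices :: "(real ^ 'n ^ 'n) set" where
  "reciprocal_matrices = {A. \<forall>i j. A $ i $ j > 0 \<and> A $ i $ j = 1 / A $ j $ i}"

definition normalize_columns :: "real ^ 'n ^ 'n \<Rightarrow> real ^ 'n ^ 'n" where
  "normalize_columns A = (\<chi> i j. A $ i $ j / (\<Sum>k\<in>UNIV. A $ k $ j))"

definition complex_eigenvalue :: "real ^ 'n ^ 'n \<Rightarrow> complex \<Rightarrow> bool" where
  "complex_eigenvalue A \<mu> \<longleftrightarrow>
     (\<exists>v :: complex ^ 'n. v \<noteq> 0 \<and> map_matrix complex_of_real A *v v = \<mu> *s v)"

(* The Perron eigenvalue: a real eigenvalue that dominates the modulus of every complex
   eigenvalue. It is unique whenever it exists, and it exists for positive matrices by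
   Perron's theorem. *)
definition lambda_max :: "real ^ 'n ^ 'n \<Rightarrow> real" where
  "lambda_max A = (THE l. complex_eigenvalue A (complex_of_real l) \<and>
                          (\<forall>\<mu>. complex_eigenvalue A \<mu> \<longrightarrow> cmod \<mu> \<le> l))"

(* For positive matrices, existence and uniqueness are again part of Perron's theorem. *)
definition eigenvalue_priority :: "real ^ 'n ^ 'n \<Rightarrow> real ^ 'n" where
  "eigenvalue_priority A = (THE w. (\<forall>i. w $ i > 0) \<and> (\<Sum>i\<in>UNIV. w $ i) = 1 \<and>
                                   A *v w = lambda_max A *s w)"

definition geometric_mean_priority :: "real ^ 'n ^ 'n \<Rightarrow> real ^ 'n" where
  "geometric_mean_priority A =
     (\<chi> i. root CARD('n) (\<Prod>j\<in>UNIV. A $ i $ j) /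
           (\<Sum>k\<in>UNIV. root CARD('n) (\<Prod>j\<in>UNIV. A $ k $ j)))"

(* The first argument is the method assigning to a matrix its normalized priority vector. *)
definition GWI :: "(real ^ 'n ^ 'n \<Rightarrow> real ^ 'n) \<Rightarrow> real ^ 'n ^ 'n \<Rightarrow> real" where
  "GWI prio A = 1 / real CARD('n) *
     (\<Sum>i\<in>UNIV. \<Sum>j\<in>UNIV. \<bar>normalize_columns A $ i $ j - prio A $ i\<bar>)"

end

theory Submission
  imports Defs
begin

text \<open>Every entry of a column-normalized positive matrix and of a priority vector lies in
  \<open>[0, 1]\<close>, so each summand of the index is at most \<open>1\<close> and the index is at most \<open>n\<close>.
  For the eigenvalue method this needs the part of Perron's theorem that makes the priority
  vector well defined. A positive eigenvector is a fixed point of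
  \<open>x \<mapsto> A x / \<parallel>A x\<parallel>\<^sub>1\<close> on the standard simplex (Brouwer).
  At an index where the ratio of the components of another eigenvector to those of the positive
  one is largest, the eigenvalue equations show that the positive eigenvector's eigenvalue
  dominates all complex ones and that the eigenvector is unique up to scaling.\<close>

lemma reciprocal_matrices_pos: "A \<in> reciprocal_matrices \<Longrightarrow> A $ i $ j > 0"
  unfolding reciprocal_matrices_def by blast

text \<open>A single positive component of \<open>x\<close> suffices, because it is weighted by a
  positive entry in every row. This strictness serves both existence and uniqueness of the Perron
  vector.\<close>

lemma matrix_vector_mult_pos:
  fixes A :: "real ^ 'n ^ 'm"
  assumes A: "\<And>i j. A $ i $ j > 0" and x: "\<And>j. x $ j \<ge> 0" and nz: "x \<noteq> 0"
  shows "(A *v x) $ i > 0"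
proof -
  obtain k where "x $ k \<noteq> 0" using nz by (auto simp: vec_eq_iff)
  then have "x $ k > 0" using x[of k] by simp
  then have "(\<Sum>j\<in>UNIV. A $ i $ j * x $ j) > 0"
    by (intro sum_pos2[of UNIV k]) (auto simp: A x less_imp_le)
  then show ?thesis by (simp add: matrix_vector_mult_def)
qed

lemma perron_eigenvector_exists:
  fixes A :: "real ^ 'n ^ 'n"
  assumes A: "\<And>i j. A $ i $ j > 0"
  obtains w l where "\<And>i. w $ i > 0" "(\<Sum>i\<in>UNIV. w $ i) = 1" "A *v w = l *s w"
proof -
  define S :: "(real ^ 'n) set" where "S = {x. (\<forall>i. 0 \<le> x $ i) \<and> (\<Sum>i\<in>UNIV. x $ i) = 1}"
  \<comment> \<open>On \<open>S\<close> the vector \<open>A *v x\<close> is positive, so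
    \<open>s x\<close> is its l1 norm and dividing by it leads back into the simplex.\<close>
  define s where "s = (\<lambda>x. \<Sum>i\<in>UNIV. (A *v x) $ i)"
  define f where "f = (\<lambda>x. (1 / s x) *\<^sub>R (A *v x))"
  have nz: "x \<noteq> 0" if "x \<in> S" for x
    using that by (auto simp: S_def)
  have pos: "(A *v x) $ i > 0" if "x \<in> S" for x i
    using that matrix_vector_mult_pos[OF A _ nz[OF that]] by (simp add: S_def)
  have s_pos: "s x > 0" if "x \<in> S" for x
    unfolding s_def by (intro sum_pos) (auto simp: pos that)
  have "closed S"
    unfolding S_def
    by (intro closed_Collect_conj closed_Collect_all closed_Collect_le closed_Collect_eq
        continuous_intros)
  moreover have "bounded S"
  proof (rule boundedI)
    fix x assume "x \<in> S"
    then show "norm x \<le> 1"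
      using norm_le_l1_cart[of x] by (simp add: S_def)
  qed
  ultimately have "compact S" by (simp add: compact_eq_bounded_closed)
  moreover have "convex S"
    by (auto simp: convex_def S_def sum.distrib simp flip: sum_distrib_left)
  moreover have "S \<noteq> {}"
  proof -
    have "(\<chi> i. 1 / real CARD('n)) \<in> S" by (simp add: S_def)
    then show ?thesis by blast
  qed
  moreover have "continuous_on S f"
    unfolding f_def s_def using s_pos
    by (intro continuous_intros matrix_vector_mult_linear_continuous_on) (force simp: s_def)+
  moreover have "f \<in> S \<rightarrow> S"
  proof
    fix x assume x: "x \<in> S"
    have "(\<Sum>i\<in>UNIV. f x $ i) = s x / s x"
      by (simp add: f_def s_def flip: sum_divide_distrib)
    moreover have "0 \<le> f x $ i" for i
      using pos[OF x, of i] s_pos[OF x] by (simp add: f_def)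
    ultimately show "f x \<in> S" using s_pos[OF x] by (simp add: S_def)
  qed
  ultimately obtain w where w: "w \<in> S" "f w = w"
    by (rule brouwer)
  have eig: "A *v w = s w *s w"
  proof -
    have "s w *\<^sub>R f w = A *v w" using s_pos[OF w(1)] by (simp add: f_def)
    then show ?thesis by (simp add: w(2) scalar_mult_eq_scaleR)
  qed
  \<comment> \<open>Membership in \<open>S\<close> only gives nonnegativity; strictness comes from
    \<open>s w * w $ i = (A *v w) $ i > 0\<close>.\<close>
  have "w $ i > 0" for i
    using pos[OF w(1), of i] s_pos[OF w(1)] by (simp add: eig zero_less_mult_iff)
  then show thesis using that[OF _ _ eig] w(1) by (simp add: S_def)
qed

text \<open>Comparison device for the two arguments below: \<open>t *s w\<close> dominates
  \<open>u\<close> and touches it at \<open>k\<close>, so the eigenvalue equations can be compared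
  in row \<open>k\<close>.\<close>

lemma max_ratio_attained:
  fixes u w :: "real ^ 'n"
  assumes w: "\<And>i. w $ i > 0"
  obtains t k where "\<And>i. u $ i \<le> t * w $ i" "u $ k = t * w $ k"
proof -
  define t where "t = Max (range (\<lambda>i. u $ i / w $ i))"
  have "t \<in> range (\<lambda>i. u $ i / w $ i)" unfolding t_def by (intro Max_in) auto
  then obtain k where "t = u $ k / w $ k" by blast
  then have "u $ k = t * w $ k" using w[of k] by simp
  moreover have "u $ i \<le> t * w $ i" for i
  proof -
    have "u $ i / w $ i \<le> t" unfolding t_def by (intro Max_ge) auto
    then show ?thesis using w[of i] by (simp add: divide_le_eq)
  qed
  ultimately show thesis using that by blast
qed

lemma complex_eigenvalue_le_perron:
  fixes A :: "real ^ 'n ^ 'n"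
  assumes A: "\<And>i j. A $ i $ j > 0" and w: "\<And>i. w $ i > 0" and eig: "A *v w = l *s w"
    and \<mu>: "complex_eigenvalue A \<mu>"
  shows "cmod \<mu> \<le> l"
proof -
  obtain v where v: "v \<noteq> 0" "map_matrix complex_of_real A *v v = \<mu> *s v"
    using \<mu> by (auto simp: complex_eigenvalue_def)
  \<comment> \<open>Passing to moduli gives a real vector comparable with \<open>w\<close>.\<close>
  define u :: "real ^ 'n" where "u = (\<chi> i. cmod (v $ i))"
  obtain t k where t: "\<And>i. u $ i \<le> t * w $ i" and k: "u $ k = t * w $ k"
    using max_ratio_attained[OF w] by metis
  \<comment> \<open>Needed to cancel \<open>u $ k\<close> at the end. Otherwise
    \<open>t \<le> 0\<close>, which forces all moduli to vanish.\<close>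
  have "u $ k > 0"
  proof (rule ccontr)
    assume "\<not> u $ k > 0"
    then have "t \<le> 0" using k w[of k] by (simp add: zero_less_mult_iff)
    then have "u $ i \<le> 0" for i
      using t[of i] w[of i] by (meson less_imp_le mult_nonpos_nonneg order_trans)
    then have "v = 0" by (simp add: u_def vec_eq_iff)
    then show False using v by simp
  qed
  \<comment> \<open>Row \<open>k\<close>: the triangle inequality, then domination by
    \<open>t *s w\<close>, then the equation for \<open>w\<close>; equality at \<open>k\<close>
    turns \<open>t * w $ k\<close> back into \<open>u $ k\<close>.\<close>
  have "cmod \<mu> * u $ k = cmod (\<Sum>j\<in>UNIV. complex_of_real (A $ k $ j) * v $ j)"
    using arg_cong[OF v(2), of "\<lambda>x. cmod (x $ k)"]
    by (simp add: matrix_vector_mult_def map_matrix_def u_def norm_mult)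
  also have "\<dots> \<le> (\<Sum>j\<in>UNIV. A $ k $ j * u $ j)"
    by (rule norm_sum[THEN order_trans]) (simp add: norm_mult u_def A less_imp_le)
  also have "\<dots> \<le> (\<Sum>j\<in>UNIV. A $ k $ j * (t * w $ j))"
    by (intro sum_mono mult_left_mono t) (simp add: A less_imp_le)
  also have "\<dots> = t * (A *v w) $ k"
    by (simp add: matrix_vector_mult_def sum_distrib_left mult_ac)
  also have "\<dots> = l * u $ k" by (simp add: eig k)
  finally show ?thesis using \<open>u $ k > 0\<close> by simp
qed

lemma lambda_max_eq:
  fixes A :: "real ^ 'n ^ 'n"
  assumes A: "\<And>i j. A $ i $ j > 0" and w: "\<And>i. w $ i > 0" and eig: "A *v w = l *s w"
  shows "lambda_max A = l"
proof -
  define v :: "complex ^ 'n" where "v = (\<chi> i. complex_of_real (w $ i))"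
  have "v \<noteq> 0" using w by (auto simp: v_def vec_eq_iff less_imp_neq[symmetric])
  moreover have "map_matrix complex_of_real A *v v = complex_of_real l *s v"
    using eig
    by (simp add: vec_eq_iff matrix_vector_mult_def map_matrix_def v_def
        flip: of_real_mult of_real_sum)
  ultimately have l: "complex_eigenvalue A (complex_of_real l)"
    by (auto simp: complex_eigenvalue_def)
  have dom: "cmod \<mu> \<le> l" if "complex_eigenvalue A \<mu>" for \<mu>
    using complex_eigenvalue_le_perron[OF A w eig that] .
  show ?thesis
    unfolding lambda_max_def
  proof (rule the_equality)
    show "complex_eigenvalue A (complex_of_real l) \<and>
        (\<forall>\<mu>. complex_eigenvalue A \<mu> \<longrightarrow> cmod \<mu> \<le> l)"
      using l dom by blast
  next
    fix m
    assume "complex_eigenvalue A (complex_of_real m) \<and>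
        (\<forall>\<mu>. complex_eigenvalue A \<mu> \<longrightarrow> cmod \<mu> \<le> m)"
    \<comment> \<open>Both \<open>l\<close> and \<open>m\<close> are eigenvalues and both dominate,
      so each bounds the other.\<close>
    then have "\<bar>l\<bar> \<le> m" "\<bar>m\<bar> \<le> l" using l dom by (metis norm_of_real)+
    then show "m = l" by simp
  qed
qed

lemma perron_eigenvector_unique:
  fixes A :: "real ^ 'n ^ 'n"
  assumes A: "\<And>i j. A $ i $ j > 0" and w: "\<And>i. w $ i > 0"
    and eig: "A *v w = l *s w" "A *v x = l *s x"
    and sums: "(\<Sum>i\<in>UNIV. w $ i) = 1" "(\<Sum>i\<in>UNIV. x $ i) = 1"
  shows "x = w"
proof -
  obtain t k where t: "\<And>i. x $ i \<le> t * w $ i" and k: "x $ k = t * w $ k"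
    using max_ratio_attained[OF w] by metis
  \<comment> \<open>\<open>d\<close> is nonnegative, vanishes at \<open>k\<close> and satisfies the
    eigenvalue equation for \<open>l\<close>. If it were nonzero, \<open>A *v d\<close> would be
    positive at \<open>k\<close>, yet that component is \<open>l * d $ k = 0\<close>.\<close>
  define d where "d = t *s w - x"
  have "A *v d = l *s d"
    by (simp add: d_def matrix_vector_mult_diff_distrib matrix_vector_mult_scaleR eig
        scalar_mult_eq_scaleR algebra_simps)
  then have "\<not> (A *v d) $ k > 0" by (simp add: d_def k)
  then have "d = 0"
    using matrix_vector_mult_pos[OF A, of d k] t by (auto simp: d_def)
  then have x: "x = t *s w" by (simp add: d_def)
  have "t = 1" using sums by (simp add: x flip: sum_distrib_left)
  then show ?thesis by (simp add: x)
qed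

text \<open>Existence and uniqueness of the Perron vector justify the definite description, once its
  eigenvalue is identified with \<open>lambda_max A\<close>.\<close>

lemma eigenvalue_priority_props:
  fixes A :: "real ^ 'n ^ 'n"
  assumes A: "\<And>i j. A $ i $ j > 0"
  shows "(\<forall>i. eigenvalue_priority A $ i > 0) \<and> (\<Sum>i\<in>UNIV. eigenvalue_priority A $ i) = 1 \<and>
    A *v eigenvalue_priority A = lambda_max A *s eigenvalue_priority A"
proof -
  obtain w l where w: "\<And>i. w $ i > 0" "(\<Sum>i\<in>UNIV. w $ i) = 1" "A *v w = l *s w"
    using perron_eigenvector_exists[OF A] by metis
  have "lambda_max A = l" by (rule lambda_max_eq[OF A w(1,3)])
  with w have eig: "A *v w = lambda_max A *s w" by simp
  show ?thesis
    unfolding eigenvalue_priority_def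
  proof (rule theI)
    show "(\<forall>i. w $ i > 0) \<and> (\<Sum>i\<in>UNIV. w $ i) = 1 \<and> A *v w = lambda_max A *s w"
      using w eig by blast
  qed (use perron_eigenvector_unique[OF A w(1) eig] w(2) in blast)
qed

lemma geometric_mean_priority_props:
  fixes A :: "real ^ 'n ^ 'n"
  assumes A: "\<And>i j. A $ i $ j > 0"
  shows "geometric_mean_priority A $ i > 0" "(\<Sum>i\<in>UNIV. geometric_mean_priority A $ i) = 1"
proof -
  define g where "g = (\<lambda>i. root CARD('n) (\<Prod>j\<in>UNIV. A $ i $ j))"
  have g: "g i > 0" for i by (simp add: g_def A prod_pos)
  then have s: "(\<Sum>k\<in>UNIV. g k) > 0" by (simp add: sum_pos)
  have eq: "geometric_mean_priority A $ i = g i / (\<Sum>k\<in>UNIV. g k)" for i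
    by (simp add: geometric_mean_priority_def g_def)
  show "geometric_mean_priority A $ i > 0" using g[of i] s by (simp add: eq)
  show "(\<Sum>i\<in>UNIV. geometric_mean_priority A $ i) = 1"
    using s by (simp add: eq flip: sum_divide_distrib)
qed

text \<open>Stated for an arbitrary \<open>prio\<close> so that it covers both methods. There are
  n^2 summands, each at most 1, and the prefactor 1/n leaves n.\<close>

lemma GWI_le_card:
  fixes A :: "real ^ 'n ^ 'n"
  assumes A: "\<And>i j. A $ i $ j > 0"
    and p: "\<And>i. prio A $ i > 0" "(\<Sum>i\<in>UNIV. prio A $ i) = 1"
  shows "GWI prio A \<le> real CARD('n)"
proof -
  have le1: "\<bar>normalize_columns A $ i $ j - prio A $ i\<bar> \<le> 1" for i j
  proof -
    have "0 < (\<Sum>k\<in>UNIV. A $ k $ j)" by (intro sum_pos) (auto simp: A)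
    moreover have "A $ i $ j \<le> (\<Sum>k\<in>UNIV. A $ k $ j)"
      by (rule member_le_sum) (auto simp: A less_imp_le)
    ultimately have "0 \<le> normalize_columns A $ i $ j" "normalize_columns A $ i $ j \<le> 1"
      using A[of i j] by (auto simp: normalize_columns_def)
    moreover have "prio A $ i \<le> (\<Sum>i\<in>UNIV. prio A $ i)"
      by (rule member_le_sum) (auto simp: p(1) less_imp_le)
    ultimately show ?thesis using p(1)[of i] p(2) by linarith
  qed
  have "(\<Sum>i\<in>UNIV. \<Sum>j\<in>UNIV. \<bar>normalize_columns A $ i $ j - prio A $ i\<bar>)
      \<le> (\<Sum>i\<in>(UNIV :: 'n set). \<Sum>j\<in>(UNIV :: 'n set). 1)"
    by (intro sum_mono le1)
  then show ?thesis by (simp add: GWI_def divide_le_eq)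
qed

theorem proposition19:
  shows "(\<exists>K :: real. \<forall>A \<in> (reciprocal_matrices :: (real ^ 'n ^ 'n) set).
            GWI eigenvalue_priority A \<le> K) \<and>
         (\<exists>K :: real. \<forall>A \<in> (reciprocal_matrices :: (real ^ 'n ^ 'n) set).
            GWI geometric_mean_priority A \<le> K)"
proof (intro conjI exI ballI)
  fix A :: "real ^ 'n ^ 'n"
  assume "A \<in> reciprocal_matrices"
  then have A: "\<And>i j. A $ i $ j > 0" by (rule reciprocal_matrices_pos)
  show "GWI eigenvalue_priority A \<le> real CARD('n)"
    using eigenvalue_priority_props[OF A] by (intro GWI_le_card A) auto
  show "GWI geometric_mean_priority A \<le> real CARD('n)"
    by (intro GWI_le_card A geometric_mean_priority_props)
qed

end
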